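(* Let $U$ be an $(r-1,k)_q$-evasive subspace of $V=V(r,q^n)$. (1) If $k<(r-1)n$, then $\dim_q U\le n+k-1$. (2) If $k<r-2+\frac{n}{r-1}$, then $\dim_q U\le n+k-r+1$.
   Context: $V(r,q^n)$ denotes an $r$-dimensional vector space over $\mathbb{F}_{q^n}$, viewed also as an $rn$-dimensional vector space over $\mathbb{F}_q$. For positive integers $h,k$, an $\mathbb{F}_q$-subspace $U$ of $V$ is $(h,k)_q$-evasive if $\langle U\rangle_{\mathbb{F}_{q^n}}$ has $\mathbb{F}_{q^n}$-dimension at least $h$ and every $h$-dimensional $\mathbb{F}_{q^n}$-subspace of $V$ meets $U$ in an $\mathbb{F}_q$-subspace of $\mathbb{F}_q$-dimension at most $k$. *)

theory Defs
  imports Complex_Main "HOL-Library.Cardinality"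
begin

definition field_embedding :: "('a::field \<Rightarrow> 'b::field) \<Rightarrow> bool" where
  "field_embedding emb \<longleftrightarrow>
     emb 1 = 1 \<and> (\<forall>x y. emb (x + y) = emb x + emb y) \<and> (\<forall>x y. emb (x * y) = emb x * emb y)"

definition restrict_scalars ::
    "('a::field \<Rightarrow> 'b::field) \<Rightarrow> ('b \<Rightarrow> 'v::ab_group_add \<Rightarrow> 'v) \<Rightarrow> 'a \<Rightarrow> 'v \<Rightarrow> 'v" where
  "restrict_scalars emb scale a v = scale (emb a) v"

lemma vector_space_restrict_scalars:
  assumes "field_embedding emb" and "vector_space scale"
  shows "vector_space (restrict_scalars emb scale)"
proof -
  interpret vector_space scale by fact
  show ?thesis
    using assms(1)
    by unfold_locales
       (simp_all add: field_embedding_def restrict_scalars_def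
          scale_right_distrib scale_left_distrib)
qed

(* The small field is the image of emb. The library's dim is 0 on infinite-dimensional
   subspaces, so the definition is meaningful for finite-dimensional V only. *)
definition evasive ::
    "('a::field \<Rightarrow> 'b::field) \<Rightarrow> ('b \<Rightarrow> 'v::ab_group_add \<Rightarrow> 'v) \<Rightarrow> nat \<Rightarrow> nat \<Rightarrow> 'v set \<Rightarrow> bool" where
  "evasive emb scale h k U \<longleftrightarrow>
     h > 0 \<and> k > 0 \<and>
     module.subspace (restrict_scalars emb scale) U \<and>
     h \<le> vector_space.dim scale (module.span scale U) \<and>
     (\<forall>W. module.subspace scale W \<and> vector_space.dim scale W = h \<longrightarrow>
        vector_space.dim (restrict_scalars emb scale) (W \<inter> U) \<le> k)"

end

theory Submission
  imports Defs "HOL-Library.FuncSet"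
begin

text \<open>With h = r - 1 the evasive condition concerns hyperplanes, the kernels of nonzero
  functionals on V. Restricted to U, the functionals form a rank-metric code: hyperplanes meet U in
  F_q-dimension at most k, so a nonzero functional has rank at least dim U - k on U. A
  Singleton-type count then bounds dim U. Take d F_q-independent vectors of U with k < d <= n + k +
  1. If a nonzero functional sent them all into an F_q-subspace T of F_{q^n} of dimension d - k - 1,
  its kernel on their span would have dimension at least k + 1. So the q^(nr) functionals are told
  apart by d values modulo T, and nr <= d(n + k + 1 - d): this is
  \<open>hyperplane_singleton_bound\<close>. If dim U is too large, d can be chosen freely below it.
  For (1), d = n + k gives nr <= n + k. For (2), d = n + k - r + 2 gives nr <= d(r - 1), that is, n
  <= (k - r + 2)(r - 1). Both contradict the hypotheses. The inequality r - 1 <= k from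
  \<open>evasive_le\<close> makes the second d admissible.\<close>

lemma card_span_independent:
  fixes scale :: "'a::{field,finite} \<Rightarrow> 'v::ab_group_add \<Rightarrow> 'v"
  assumes "vector_space scale" and fin: "finite B" and ind: "\<not> module.dependent scale B"
  shows "finite (module.span scale B)" "card (module.span scale B) = CARD('a) ^ card B"
proof -
  interpret vector_space scale by fact
  let ?F = "B \<rightarrow>\<^sub>E (UNIV :: 'a set)"
  let ?c = "\<lambda>a. \<Sum>b\<in>B. scale (a b) b"
  have inj: "inj_on ?c ?F"
  proof (rule inj_onI)
    fix a a' assume a: "a \<in> ?F" "a' \<in> ?F" and eq: "?c a = ?c a'"
    have "(\<Sum>b\<in>B. scale (a b - a' b) b) = 0"
      using eq by (simp add: scale_left_diff_distrib sum_subtractf)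
    then have "a b - a' b = 0" if "b \<in> B" for b
      using independentD[OF ind fin subset_refl, of "\<lambda>b. a b - a' b"] that by blast
    then show "a = a'"
      by (intro PiE_ext[OF a]) auto
  qed
  have img: "?c ` ?F = span B"
  proof
    show "?c ` ?F \<subseteq> span B"
      unfolding span_finite[OF fin] by blast
    show "span B \<subseteq> ?c ` ?F"
    proof
      fix x assume "x \<in> span B"
      then obtain u where "x = (\<Sum>b\<in>B. scale (u b) b)"
        unfolding span_finite[OF fin] by blast
      then have "x = ?c (restrict u B)" "restrict u B \<in> ?F" by auto
      then show "x \<in> ?c ` ?F" by blast
    qed
  qed
  show "finite (span B)"
    using fin by (simp flip: img add: finite_PiE)
  show "card (span B) = CARD('a) ^ card B"
    using fin by (simp flip: img add: card_image[OF inj] card_PiE)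
qed

lemma card_subspace:
  fixes scale :: "'a::{field,finite} \<Rightarrow> 'v::ab_group_add \<Rightarrow> 'v"
  assumes "vector_space scale" and "finite S" and "module.subspace scale S"
  shows "card S = CARD('a) ^ vector_space.dim scale S"
proof -
  interpret vector_space scale by fact
  obtain B where B: "B \<subseteq> S" "independent B" "S \<subseteq> span B" "card B = dim S"
    by (rule basis_exists)
  moreover have "span B = S"
    using B assms(3) by (simp add: span_minimal subset_antisym)
  moreover have "finite B"
    using B(1) assms(2) by (rule finite_subset)
  ultimately show ?thesis
    using card_span_independent(2)[OF assms(1), of B] by simp
qed

text \<open>Each nonempty fibre is a translate of the kernel. Working with additive groups alone
  makes the count usable both for V over the big field and for an F_q-span inside U.\<close>

lemma card_eq_card_image_times_kernel:
  fixes f :: "'v::ab_group_add \<Rightarrow> 'w::ab_group_add"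
  assumes fin: "finite A"
    and diff: "\<And>x y. x \<in> A \<Longrightarrow> y \<in> A \<Longrightarrow> x - y \<in> A"
    and f: "\<And>x y. f (x - y) = f x - f y"
  shows "card A = card (f ` A) * card {x \<in> A. f x = 0}"
proof -
  have add: "x + y \<in> A" if "x \<in> A" "y \<in> A" for x y
    using diff[of x "y - y - y"] diff[of "y - y" y] diff[of y y] that by auto
  have fadd: "f (x + y) = f x + f y" for x y
    using f[of "x + y" y] by (simp add: algebra_simps)
  have fibre: "card {x \<in> A. f x = y} = card {x \<in> A. f x = 0}" if "y \<in> f ` A" for y
  proof -
    from that obtain x0 where x0: "x0 \<in> A" "f x0 = y" by blast
    have "bij_betw (\<lambda>x. x + x0) {x \<in> A. f x = 0} {x \<in> A. f x = y}"
      by (rule bij_betw_byWitness[where f' = "\<lambda>x. x - x0"])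
         (use x0 add diff in \<open>auto simp: f fadd\<close>)
    then show ?thesis by (simp add: bij_betw_same_card)
  qed
  have "card A = (\<Sum>y\<in>f ` A. card {x \<in> A. f x = y})"
    using sum.image_gen[OF fin, of "\<lambda>_. 1 :: nat" f] by simp
  also have "\<dots> = card (f ` A) * card {x \<in> A. f x = 0}"
    by (simp add: fibre)
  finally show ?thesis .
qed

lemma vector_space_field: "vector_space ((*) :: 'b::field \<Rightarrow> 'b \<Rightarrow> 'b)"
  by unfold_locales (simp_all add: algebra_simps)

lemma field_embedding_eq_0_iff:
  assumes "field_embedding emb"
  shows "emb x = 0 \<longleftrightarrow> x = 0"
proof
  have "emb (0 + 0) = emb 0 + emb 0" using assms unfolding field_embedding_def by blast
  then have "emb 0 = 0" by (metis add_0 add_cancel_right_right)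
  then show "x = 0 \<Longrightarrow> emb x = 0" by simp
  show "x = 0" if "emb x = 0"
  proof (rule ccontr)
    assume "x \<noteq> 0"
    then have "emb x * emb (inverse x) = 1"
      using assms unfolding field_embedding_def by (metis right_inverse)
    then show False using that by simp
  qed
qed

lemma independent_restrict_scalars:
  assumes emb: "field_embedding emb" and "vector_space scale"
    and ind: "\<not> module.dependent scale B"
  shows "\<not> module.dependent (restrict_scalars emb scale) B"
proof -
  interpret vector_space scale by fact
  interpret R: vector_space "restrict_scalars emb scale"
    using emb \<open>vector_space scale\<close> by (rule vector_space_restrict_scalars)
  show ?thesis
    unfolding R.independent_explicit_module
  proof (intro allI impI)
    fix t u v
    assume t: "finite t" "t \<subseteq> B" "(\<Sum>v\<in>t. restrict_scalars emb scale (u v) v) = 0" "v \<in> t"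
    have "emb (u v) = 0"
      using independentD[OF ind t(1,2), of "\<lambda>v. emb (u v)"] t(3,4)
      by (simp add: restrict_scalars_def)
    then show "u v = 0" by (simp add: field_embedding_eq_0_iff[OF emb])
  qed
qed

text \<open>
  This is the Singleton bound for the rank-metric code formed by the restrictions to \<open>U\<close> of the
  linear functionals on \<open>V\<close>. The functionals are separated by their values on \<open>d\<close> independent
  vectors of \<open>U\<close>, read modulo a \<open>(d - k - 1)\<close>-dimensional subspace \<open>T\<close> of the big field: a
  nonzero functional mapping these vectors into \<open>T\<close> would have a kernel, a hyperplane, meeting
  \<open>U\<close> in dimension more than \<open>k\<close>.
\<close>

lemma hyperplane_singleton_bound:
  fixes emb :: "'a::{field,finite} \<Rightarrow> 'b::{field,finite}"
    and scale :: "'b \<Rightarrow> 'v::ab_group_add \<Rightarrow> 'v"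
  assumes card_b: "CARD('b) = CARD('a) ^ n"
    and emb: "field_embedding emb"
    and V: "vector_space scale"
    and fin: "finite (UNIV :: 'v set)"
    and r: "vector_space.dim scale UNIV = r"
    and sub: "module.subspace (restrict_scalars emb scale) U"
    and hyp: "\<And>W. module.subspace scale W \<Longrightarrow> vector_space.dim scale W = r - 1 \<Longrightarrow>
      vector_space.dim (restrict_scalars emb scale) (W \<inter> U) \<le> k"
    and d: "d \<le> vector_space.dim (restrict_scalars emb scale) U" "k < d" "d \<le> n + k + 1"
  shows "n * r \<le> d * (n + k + 1 - d)"
proof -
  interpret vector_space scale by fact
  interpret R: vector_space "restrict_scalars emb scale"
    using emb V by (rule vector_space_restrict_scalars)
  interpret F: vector_space "restrict_scalars emb ((*) :: 'b \<Rightarrow> 'b \<Rightarrow> 'b)"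
    using emb vector_space_field by (rule vector_space_restrict_scalars)
  have finV [simp]: "finite A" for A :: "'v set"
    using fin by (rule finite_subset[OF subset_UNIV])
  have "card {0, 1 :: 'a} \<le> CARD('a)" by (rule card_mono) auto
  then have q: "CARD('a) > 1" by simp
  obtain B where B: "independent B" "span B = UNIV" "card B = r"
    using basis_exists[of UNIV] r by (metis top.extremum_uniqueI)
  obtain E where E: "E \<subseteq> U" "R.independent E" "card E = d"
  proof -
    obtain E' where E': "E' \<subseteq> U" "R.independent E'" "card E' = R.dim U"
      by (rule R.basis_exists[of U])
    then obtain E where "E \<subseteq> E'" "card E = d"
      using d(1) obtain_subset_with_card_n by metis
    then show thesis using E' that R.independent_mono by blast
  qed
  obtain C where C: "F.independent C" "F.span C = UNIV"
    using F.basis_exists[of UNIV] by (metis top.extremum_uniqueI)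
  \<comment> \<open>The degree n enters only through cardinalities, so it is identified with the
    F_q-dimension of the big field by comparing powers of q.\<close>
  have card_C: "card C = n"
    using card_span_independent(2)[OF F.vector_space_axioms _ C(1)] C(2) card_b q by simp
  obtain D where D: "D \<subseteq> C" "card D = d - k - 1"
  proof -
    have "d - k - 1 \<le> card C" using d(3) card_C by simp
    then show thesis using obtain_subset_with_card_n that by metis
  qed
  define T where "T = F.span D"
  have card_T: "card T = CARD('a) ^ (d - k - 1)"
    unfolding T_def using card_span_independent(2)[OF F.vector_space_axioms _ F.independent_mono[OF C(1) D(1)]] D(2)
    by simp
  \<comment> \<open>Hence the coordinates indexed by \<open>C - D\<close> determine an element of
    the big field modulo \<open>T\<close>.\<close>
  have T_iff: "x \<in> T" if "\<And>c. c \<in> C - D \<Longrightarrow> F.representation C x c = 0" for x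
  proof -
    have "x = (\<Sum>c\<in>C. restrict_scalars emb (*) (F.representation C x c) c)"
      using F.sum_representation_eq[OF C(1), of x C] C(2) by simp
    also have "\<dots> = (\<Sum>c\<in>D. restrict_scalars emb (*) (F.representation C x c) c)"
      using that D(1) by (intro sum.mono_neutral_right) auto
    also have "\<dots> \<in> T"
      unfolding T_def by (intro F.span_sum F.span_scale F.span_base)
    finally show ?thesis .
  qed
  \<comment> \<open>\<open>h a\<close> is the linear functional taking the values \<open>a\<close>
    on the basis \<open>B\<close>; all functionals arise in this way.\<close>
  define h where "h a v = (\<Sum>b\<in>B. a b * representation B v b)" for a v
  have h_add: "h a (v + w) = h a v + h a w" for a v w
    unfolding h_def using B(1,2) by (simp add: representation_add ring_distribs sum.distrib)
  have h_scale: "h a (scale c v) = c * h a v" for a v c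
    unfolding h_def using B(1,2) by (simp add: representation_scale sum_distrib_left mult_ac)
  have h_diff: "h a (v - w) = h a v - h a w" for a v w
    using h_add[of a "v - w" w] by (simp add: algebra_simps)
  have h_left_diff: "h (\<lambda>b. a b - a' b) v = h a v - h a' v" for a a' v
    unfolding h_def by (simp add: left_diff_distrib sum_subtractf)
  have h_basis: "h a b = a b" if "b \<in> B" for a b
    unfolding h_def using that B(1) by (simp add: representation_basis if_distrib cong: if_cong)
  have h_zero: "h a v = 0" if a: "\<And>u. u \<in> E \<Longrightarrow> h a u \<in> T" for a v
  proof (rule ccontr)
    assume nz: "h a v \<noteq> 0"
    define W where "W = {x. h a x = 0}"
    have subW: "subspace W"
      unfolding W_def subspace_def using h_scale[of a 0 0] by (auto simp: h_add h_scale)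
    have "range (h a) = UNIV"
    proof -
      have "h a (scale (c / h a v) v) = c" for c
        using nz by (simp add: h_scale)
      then show ?thesis by (rule surjI)
    qed
    \<comment> \<open>A nonzero functional is onto, so comparing cardinalities shows that its kernel
      \<open>W\<close> has dimension r - 1.\<close>
    then have "CARD('b) ^ r = CARD('b) * card W"
      using card_eq_card_image_times_kernel[of UNIV "h a"] card_subspace[OF V, of UNIV]
      by (simp add: h_diff r W_def)
    then have "CARD('b) ^ r = CARD('b) ^ Suc (dim W)"
      using card_subspace[OF V _ subW] by simp
    moreover have "CARD('b) > 1"
      using card_mono[of UNIV "{0, 1 :: 'b}"] by simp
    ultimately have "r = Suc (dim W)" using power_inject_exp by blast
    then have le_k: "R.dim (W \<inter> U) \<le> k"
      using hyp[OF subW] by simp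
    have subR: "R.subspace W"
      using subW unfolding R.subspace_def subspace_def restrict_scalars_def by blast
    \<comment> \<open>The contradiction comes from counting \<open>U'\<close> twice: it has q^d
      elements, but at most q^k in the kernel and q^(d-k-1) in the image, hence at most
      q^(d-1).\<close>
    define U' where "U' = R.span E"
    have "U' \<subseteq> U"
      unfolding U'_def using E(1) sub by (rule R.span_minimal)
    then have "card {x \<in> U'. h a x = 0} \<le> card (W \<inter> U)"
      by (intro card_mono) (auto simp: W_def)
    also have "\<dots> = CARD('a) ^ R.dim (W \<inter> U)"
      using card_subspace[OF R.vector_space_axioms _ R.subspace_inter[OF subR sub]] by simp
    also have "\<dots> \<le> CARD('a) ^ k"
      using le_k q by (intro power_increasing) auto
    finally have ker: "card {x \<in> U'. h a x = 0} \<le> CARD('a) ^ k" .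
    have "h a x \<in> T" if "x \<in> U'" for x
      using that unfolding U'_def
    proof (induction rule: R.span_induct_alt)
      case base
      show ?case using h_scale[of a 0 0] by (simp add: T_def F.span_zero)
    next
      case (step c x y)
      have "h a (restrict_scalars emb scale c x + y) = restrict_scalars emb (*) c (h a x) + h a y"
        by (simp add: h_add restrict_scalars_def h_scale)
      then show ?case
        using step a by (simp add: T_def F.span_add F.span_scale)
    qed
    then have "card (h a ` U') \<le> card T"
      by (intro card_mono) auto
    then have "card U' \<le> CARD('a) ^ (d - k - 1) * CARD('a) ^ k"
      using ker card_T card_eq_card_image_times_kernel[of U' "h a"]
      by (simp add: h_diff U'_def R.span_diff mult_le_mono)
    moreover have "card U' = CARD('a) ^ d"
      unfolding U'_def using card_span_independent(2)[OF R.vector_space_axioms _ E(2)] E(3) by simp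
    ultimately have "CARD('a) ^ d \<le> CARD('a) ^ (d - 1)"
      using d(2) by (simp flip: power_add)
    then have "d \<le> d - 1"
      using q power_le_imp_le_exp by blast
    then show False using d(2) by simp
  qed
  \<comment> \<open>\<open>?G a\<close> is the table of the values of \<open>h a\<close> on
    \<open>E\<close> modulo \<open>T\<close>, with d rows of n - (d - k - 1) entries in F_q. By
    linearity and \<open>h_zero\<close> it determines \<open>a\<close>.\<close>
  let ?G = "\<lambda>a. \<lambda>(u, c)\<in>E \<times> (C - D). F.representation C (h a u) c"
  have "inj_on ?G (B \<rightarrow>\<^sub>E UNIV)"
  proof (rule inj_onI)
    fix a a' assume a: "a \<in> B \<rightarrow>\<^sub>E UNIV" "a' \<in> B \<rightarrow>\<^sub>E UNIV" and eq: "?G a = ?G a'"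
    have "h (\<lambda>b. a b - a' b) u \<in> T" if "u \<in> E" for u
    proof (rule T_iff)
      fix c assume c: "c \<in> C - D"
      have "F.representation C (h a u) c = F.representation C (h a' u) c"
        using fun_cong[OF eq, of "(u, c)"] c that by simp
      then show "F.representation C (h (\<lambda>b. a b - a' b) u) c = 0"
        using C by (simp add: h_left_diff F.representation_diff)
    qed
    then have "h (\<lambda>b. a b - a' b) v = 0" for v by (rule h_zero)
    then have "a b = a' b" if "b \<in> B" for b
      using h_basis[OF that, of "\<lambda>b. a b - a' b"] by simp
    then show "a = a'" by (rule PiE_ext[OF a])
  qed
  moreover have "?G ` (B \<rightarrow>\<^sub>E UNIV) \<subseteq> (E \<times> (C - D)) \<rightarrow>\<^sub>E UNIV"
    by (intro image_subsetI restrict_PiE_iff[THEN iffD2]) simp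
  ultimately have "card (B \<rightarrow>\<^sub>E (UNIV :: 'b set)) \<le> card ((E \<times> (C - D)) \<rightarrow>\<^sub>E (UNIV :: 'a set))"
    by (intro card_inj_on_le) (auto intro!: finite_PiE)
  then have "CARD('b) ^ r \<le> CARD('a) ^ (d * (n - (d - k - 1)))"
    using B(3) E(3) D card_C by (simp add: card_PiE card_cartesian_product card_Diff_subset)
  then have "CARD('a) ^ (n * r) \<le> CARD('a) ^ (d * (n - (d - k - 1)))"
    by (simp add: card_b power_mult)
  then have "n * r \<le> d * (n - (d - k - 1))"
    using q power_le_imp_le_exp by blast
  moreover have "n - (d - k - 1) = n + k + 1 - d"
    using d by simp
  ultimately show ?thesis by simp
qed

text \<open>U contains h vectors independent over the big field. They stay independent over F_q, and
  their big-field span is an h-dimensional subspace that meets U in F_q-dimension at least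
  h.\<close>

lemma evasive_le:
  fixes emb :: "'a::field \<Rightarrow> 'b::field" and scale :: "'b \<Rightarrow> 'v::ab_group_add \<Rightarrow> 'v"
  assumes emb: "field_embedding emb" and V: "vector_space scale"
    and fin: "finite (UNIV :: 'v set)"
    and ev: "evasive emb scale h k U"
  shows "h \<le> k"
proof -
  interpret vector_space scale by fact
  interpret R: vector_space "restrict_scalars emb scale"
    using emb V by (rule vector_space_restrict_scalars)
  obtain B' where B': "B' \<subseteq> U" "independent B'" "card B' = dim U"
    by (rule basis_exists[of U])
  moreover have "h \<le> dim U"
    using ev by (simp add: evasive_def)
  ultimately obtain B where B: "B \<subseteq> U" "independent B" "card B = h"
    using obtain_subset_with_card_n[of h B'] independent_mono by (metis subset_trans)
  have "h = R.dim B"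
    using R.dim_eq_card_independent[OF independent_restrict_scalars[OF emb V B(2)]] B(3) by simp
  also have "\<dots> \<le> R.dim (span B \<inter> U)"
  proof -
    obtain A where A: "A \<subseteq> span B \<inter> U" "span B \<inter> U \<subseteq> R.span A" "card A = R.dim (span B \<inter> U)"
      by (rule R.basis_exists)
    have "B \<subseteq> R.span A"
      using A(2) B(1) span_superset by blast
    moreover have "finite A" using fin by (rule finite_subset[OF subset_UNIV])
    ultimately show ?thesis
      using R.dim_le_card A(3) by metis
  qed
  also have "\<dots> \<le> k"
    using ev B(2,3) by (simp add: evasive_def dim_eq_card_independent)
  finally show ?thesis .
qed

theorem theorem4p2:
  fixes emb :: "'a::{field,finite} \<Rightarrow> 'b::{field,finite}"
    and scale :: "'b \<Rightarrow> 'v::ab_group_add \<Rightarrow> 'v"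
    and q n r k :: nat
    and U :: "'v set"
  assumes "CARD('a) = q" and "CARD('b) = q ^ n"
    and "field_embedding emb"
    and "vector_space scale"
    and "\<exists>B. finite B \<and> module.span scale B = UNIV"
    and "vector_space.dim scale UNIV = r"
    and "evasive emb scale (r - 1) k U"
  shows "(k < (r - 1) * n \<longrightarrow>
           int (vector_space.dim (restrict_scalars emb scale) U) \<le> int n + int k - 1) \<and>
         (real k < real r - 2 + real n / (real r - 1) \<longrightarrow>
           int (vector_space.dim (restrict_scalars emb scale) U) \<le> int n + int k - int r + 1)"
proof -
  interpret vector_space scale by fact
  \<comment> \<open>A finite spanning set over a finite field makes V finite, which the counting
    arguments require.\<close>
  have fin: "finite (UNIV :: 'v set)"
  proof -
    obtain B where B: "finite B" "span B = UNIV" using assms(5) by blast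
    obtain C where "C \<subseteq> B" "independent C" "span C = span B"
      by (metis maximal_independent_subset span_minimal span_mono subset_antisym subspace_span)
    then show ?thesis
      using card_span_independent(1)[OF assms(4), of C] B finite_subset by metis
  qed
  have "r - 1 > 0" using assms(7) by (simp add: evasive_def)
  then have r2: "r \<ge> 2" by simp
  have n0: "n > 0"
    using assms(2) card_mono[of UNIV "{0, 1 :: 'b}"] by (cases n) auto
  have rk: "r - 1 \<le> k"
    by (rule evasive_le[OF assms(3,4) fin assms(7)])
  let ?m = "vector_space.dim (restrict_scalars emb scale) U"
  have bound: "n * r \<le> d * (n + k + 1 - d)" if "d \<le> ?m" "k < d" "d \<le> n + k + 1" for d
    using assms(7) that
    by (intro hyperplane_singleton_bound[OF _ assms(3,4) fin assms(6)])
       (auto simp: evasive_def assms(1,2))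
  show ?thesis
  proof (intro conjI impI)
    assume k: "k < (r - 1) * n"
    show "int ?m \<le> int n + int k - 1"
    proof (rule ccontr)
      assume "\<not> ?thesis"
      \<comment> \<open>For d = n + k the second factor of the bound is 1; n > 0 ensures k <
        d.\<close>
      then have "n * r \<le> n + k"
        using bound[of "n + k"] n0 by simp
      then show False
        using k r2 by (simp add: algebra_simps)
    qed
  next
    assume k: "real k < real r - 2 + real n / (real r - 1)"
    have r1: "real r - 1 > 0" using r2 by simp
    have "real k - real (r - 2) < real n / (real r - 1)"
      using k r2 by (simp add: of_nat_diff)
    then have "(real k - real (r - 2)) * (real r - 1) < real n"
      using r1 by (simp add: pos_less_divide_eq)
    \<comment> \<open>The natural-number subtractions are exact since r >= 2 and k >= r - 1.\<close>
    moreover have "real (k - (r - 2)) = real k - real (r - 2)" "real (r - 1) = real r - 1"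
      using r2 rk by (simp_all add: of_nat_diff)
    ultimately have "real (k - (r - 2)) * real (r - 1) < real n"
      by simp
    then have k': "(k - (r - 2)) * (r - 1) < n"
      by (metis of_nat_less_iff of_nat_mult)
    \<comment> \<open>As k - (r - 2) is at least 1, this yields r - 1 < n, which makes d = n + (k -
      (r - 2)) exceed k.\<close>
    moreover have "1 * (r - 1) \<le> (k - (r - 2)) * (r - 1)"
      using rk r2 by (intro mult_le_mono1) simp
    ultimately have rn: "r - 1 < n" by linarith
    show "int ?m \<le> int n + int k - int r + 1"
    proof (rule ccontr)
      assume "\<not> ?thesis"
      \<comment> \<open>For d = n + (k - (r - 2)) the second factor n + k + 1 - d is r - 1.\<close>
      then have "n * r \<le> (n + (k - (r - 2))) * (r - 1)"
        using bound[of "n + (k - (r - 2))"] rn rk r2 by simp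
      also have "\<dots> < n * (r - 1) + n"
        using k' by (simp add: add_mult_distrib)
      also have "\<dots> = n * r"
        using r2 by (cases r) auto
      finally show False by simp
    qed
  qed
qed

end
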